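(* Let $X\subseteq\mathbb{R}^n$ be nonempty, closed and convex, and let $f:\mathbb{R}^n\to\mathbb{R}$ be quasi-convex and continuous, with minimum value $f^*$ over $X$ and set of minima $X^*$. Let $p\in(0,1]$ and $L>0$ be such that $f(x)-f^*\le L\,\mathrm{dist}^p(x,X^* )$ for each $x\in\mathbb{R}^n$. Let $\epsilon>0$ and $\delta>0$, and let $\{x_k\}_{k\in\mathbb{N}}$ be generated by the inexact subgradient method: $x_1\in\mathbb{R}^n$ and, for each $k\in\mathbb{N}$, $x_{k+1}:=\mathbb{P}_X(x_k-v_kg_k)$ with $g_k\in\partial^*_\epsilon f(x_k)$, $\|g_k\|=1$. (i) Let $K_1:=\frac{L^{1/p}\mathrm{dist}^2(x_1,X^* )}{2v\delta}$ and $v_k\equiv v>0$. Then $$\min_{1\le k\le K_1}f(x_k)\le f^*+\left(\tfrac12L^{\frac1p}v+\delta\right)^p+\epsilon.$$ (ii) Let $K_2:=\left(\frac{(1-s)L^{1/p}\mathrm{dist}^2(x_1,X^* )}{2c\delta}\right)^{\frac1{1-s}}$ and $v_k:=ck^{-s}$, where $c>0$, $s\in(0,1)$. Then $$\min_{1\le k\le K_2}f(x_k)\le f^*+\left(\tfrac12L^{\frac1p}ck^{-s}+\delta\right)^p+\epsilon.$$ (iii) Let $K_3:=\frac{L^{2/p}\mathrm{dist}^2(x_1,X^* )}{\underline{\lambda}(2-\overline{\lambda})\delta^2}$ and $v_k:=\lambda_k\left(\frac{f(x_k)-f^*-\epsilon}{L}\right)_+^{\frac1p}$, where $0<\underline{\lambda}\le\lambda_k\le\overline{\lambda}<2$.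 Then $$\min_{1\le k\le K_3}f(x_k)\le f^*+\delta^p+\epsilon.$$
   Context: $\mathbb{N}=\{1,2,\dots\}$; $\|\cdot\|$ is the Euclidean norm, $\mathrm{dist}(x,Z)=\min_{z\in Z}\|x-z\|$, $\mathbb{P}_X$ is the Euclidean projection onto $X$, $(t)_+=\max\{t,0\}$. $f$ is quasi-convex if $f((1-a)x+ay)\le\max\{f(x),f(y)\}$ for all $x,y$ and $a\in[0,1]$. The $\epsilon$-quasi-subdifferential is $\partial^*_\epsilon f(x):=\{g\in\mathbb{R}^n:\langle g,y-x\rangle\le0\ \text{for all } y \text{ with } f(y)<f(x)-\epsilon\}$. In (ii) the index $k$ also appears on the right-hand side, as printed; the meaning is that $f(x_k)\le f^*+(\frac12L^{1/p}ck^{-s}+\delta)^p+\epsilon$ for some $k$ with $1\le k\le K_2$.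
   Formalization: As printed, (ii) is false even for K_2=1, and the bounds can fail for non-integer K. Here K_1, K_3 are rounded up (at least one iteration), and in (ii) k ranges up to (1+K_2^{1-s})^{1/(1-s)}-1, rounded up likewise, instead of K_2. *)

theory Defs
  imports "HOL-Analysis.Analysis"
begin

definition quasi_convex :: "(real ^ 'n \<Rightarrow> real) \<Rightarrow> bool" where
  "quasi_convex f \<longleftrightarrow>
     (\<forall>x y. \<forall>a\<in>{0..1}. f ((1 - a) *\<^sub>R x + a *\<^sub>R y) \<le> max (f x) (f y))"

definition quasi_subdifferential :: "real \<Rightarrow> (real ^ 'n \<Rightarrow> real) \<Rightarrow> real ^ 'n \<Rightarrow> (real ^ 'n) set" where
  "quasi_subdifferential \<epsilon> f x = {g. \<forall>y. f y < f x - \<epsilon> \<longrightarrow> g \<bullet> (y - x) \<le> 0}"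

(* Sequences are indexed from 1; the values at index 0 are unconstrained. *)
definition inexact_subgradient_method ::
  "(real ^ 'n) set \<Rightarrow> (real ^ 'n \<Rightarrow> real) \<Rightarrow> real \<Rightarrow> (nat \<Rightarrow> real) \<Rightarrow>
   (nat \<Rightarrow> real ^ 'n) \<Rightarrow> (nat \<Rightarrow> real ^ 'n) \<Rightarrow> bool" where
  "inexact_subgradient_method X f \<epsilon> v g x \<longleftrightarrow>
     (\<forall>k\<ge>1. g k \<in> quasi_subdifferential \<epsilon> f (x k) \<and> norm (g k) = 1 \<and>
             x (Suc k) = closest_point X (x k - v k *\<^sub>R g k))"

(* Index set of "min over 1 <= k <= K" for a real iteration count K >= 0: K is rounded up,
   to at least one iteration.  For K a positive integer this is {1..K}.
   Rounding down would leave an empty set for K < 1, and the bounds fail for it in general. *)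
definition iterations :: "real \<Rightarrow> nat set" where
  "iterations K = {1..max 1 (nat \<lceil>K\<rceil>)}"

(* Correction of an iteration count K for the step sizes c * k powr (-s), 0 < s < 1.
   The count K itself would require  sum_{k=1..N} k powr (-s) >= N powr (1-s) / (1-s),
   which is false for every N >= 1 (the reverse strict inequality holds).  The true bound is
     sum_{k=1..N} k powr (-s) >= ((N+1) powr (1-s) - 1) / (1-s),
   and  ((N+1) powr (1-s) - 1) = K powr (1-s)  solved for N is the value below.
   It is asymptotic to K as K tends to infinity. *)
definition corrected_count :: "real \<Rightarrow> real \<Rightarrow> real" where
  "corrected_count s K = (1 + K powr (1 - s)) powr (1 / (1 - s)) - 1"

end

theory Submission
  imports Defs
begin

text \<open>
  If f(x) > fstar + \<epsilon>, the order-p bound on f makes every point within distance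
  r = ((f(x) - fstar - \<epsilon>) / L)^(1/p) of a minimum z strictly better than f(x) - \<epsilon>.
  Testing the quasi-subgradient g at z + t g for t < r yields that the inner product of
  g with x - z is at least r, so a projected step of length v decreases the squared distance to z
  by at least 2 v r - v^2.  As long as the claimed bound fails, r exceeds v/2 + \<delta> / L^(1/p)
  (respectively \<delta> / L^(1/p)); summing the decrements and comparing with the squared distance
  from the first iterate to its nearest minimum limits the number of such iterations.
\<close>

text \<open>Tangent-line bound from concavity, obtained without derivatives: Young's inequality with
  weights q and 1 - q bounds \<open>(a + 1) powr q * a powr (1 - q)\<close> by a + q, and
  multiplying by \<open>a powr (q - 1)\<close> finishes.\<close>

lemma powr_diff_le:
  fixes a q :: real
  assumes "0 < a" "0 \<le> q" "q \<le> 1"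
  shows "(a + 1) powr q - a powr q \<le> q * a powr (q - 1)"
proof -
  have "(a + 1) powr q * a powr (1 - q) \<le> q * (a + 1) + (1 - q) * a"
    using assms by (intro Youngs_inequality_0) auto
  then have "(a + 1) powr q * (a powr (1 - q) * a powr (q - 1)) \<le> (a + q) * a powr (q - 1)"
    unfolding mult.assoc[symmetric] by (intro mult_right_mono) (auto simp: algebra_simps)
  moreover have "a powr (1 - q) * a powr (q - 1) = 1"
    using assms by (simp flip: powr_add)
  moreover have "a * a powr (q - 1) = a powr q"
    using assms by (simp add: powr_mult_base)
  ultimately show ?thesis
    by (simp add: distrib_right)
qed

text \<open>The left side is the integral of \<open>t powr (- s)\<close> from 1 to N + 1. The
  induction telescopes it: each summand dominates the increment from k to k + 1.\<close>

lemma sum_powr_minus_ge: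
  fixes s :: real
  assumes "0 < s" "s < 1"
  shows "((real N + 1) powr (1 - s) - 1) / (1 - s) \<le> (\<Sum>k=1..N. real k powr (- s))"
proof (induction N)
  case 0
  then show ?case by simp
next
  case (Suc N)
  have "(real (Suc N) + 1) powr (1 - s) - real (Suc N) powr (1 - s)
          \<le> (1 - s) * real (Suc N) powr (1 - s - 1)"
    using assms by (intro powr_diff_le) auto
  then have "((real (Suc N) + 1) powr (1 - s) - real (Suc N) powr (1 - s)) / (1 - s)
          \<le> real (Suc N) powr (- s)"
    using assms by (simp add: pos_divide_le_eq mult.commute)
  then show ?case
    using Suc.IH by (simp add: diff_divide_distrib add.commute)
qed

lemma sum_decrements_less:
  fixes a w :: "nat \<Rightarrow> real"
  assumes "1 \<le> N" "\<And>k. k \<in> {1..N} \<Longrightarrow> a (Suc k) < a k - w k" "0 \<le> a (Suc N)"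
  shows "sum w {1..N} < a 1"
proof -
  have "sum w {1..N} < (\<Sum>k=1..N. a k - a (Suc k))"
    using assms by (intro sum_strict_mono) (auto simp: less_diff_eq add.commute)
  also have "\<dots> = a 1 - a (Suc N)"
    using sum_Suc_diff[of 1 N "\<lambda>k. - a k"] assms(1) by simp
  finally show ?thesis
    using assms(3) by simp
qed

lemma finite_iterations: "finite (iterations K)"
  by (simp add: iterations_def)

lemma iterations_nonempty: "iterations K \<noteq> {}"
  by (simp add: iterations_def)

lemma Min_iterations_le:
  assumes "\<exists>k\<in>iterations K. h k \<le> b"
  shows "(MIN k\<in>iterations K. h k) \<le> b"
  using assms by (subst Min_le_iff) (auto simp: finite_iterations iterations_nonempty)

text \<open>Common skeleton of the three parts: \<open>h\<close> is the objective value,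
  \<open>b\<close> the claimed bound, \<open>a\<close> the squared distance to a fixed minimum,
  \<open>w\<close> the decrement forced by a failure. If every iteration failed, the decrements
  would sum to less than \<open>a 1\<close>. The bound may vary with k, as part (ii)
  requires.\<close>

lemma exists_iterations_le:
  fixes a w h b :: "nat \<Rightarrow> real"
  assumes "\<And>k. 1 \<le> k \<Longrightarrow> b k < h k \<Longrightarrow> a (Suc k) < a k - w k"
    and "\<And>k. 0 \<le> a k"
    and "\<And>N. 1 \<le> N \<Longrightarrow> K \<le> real N \<Longrightarrow> a 1 \<le> sum w {1..N}"
  shows "\<exists>k\<in>iterations K. h k \<le> b k"
proof (rule ccontr)
  assume neg: "\<not> ?thesis"
  define N where "N = max 1 (nat \<lceil>K\<rceil>)"
  have N: "1 \<le> N" "K \<le> real N"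
    by (auto simp: N_def max_def real_nat_ceiling_ge split: if_splits) linarith
  have "sum w {1..N} < a 1"
    using N neg assms(1,2)
    by (intro sum_decrements_less) (auto simp: iterations_def N_def not_le)
  with assms(3)[OF N] show False by simp
qed

lemma quasi_subgradient_inner_ge:
  fixes f :: "real ^ 'n \<Rightarrow> real"
  assumes bound: "\<And>y. f y - fstar \<le> L * infdist y Z powr p"
    and "0 < p" "0 < L" "z \<in> Z"
    and g: "g \<in> quasi_subdifferential \<epsilon> f x" "norm g = 1"
    and r: "0 < r" "L * r powr p \<le> f x - fstar - \<epsilon>"
  shows "r \<le> g \<bullet> (x - z)"
\<comment> \<open>Membership in the quasi-subdifferential tests only strictly better points, and at
  t = r the growth bound may give mere equality. Hence every t < r is tested and the bound passes to
  the limit.\<close>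
proof (rule dense_le_bounded[of 0 r])
  show "0 < r" by fact
next
  fix t assume t: "0 < t" "t < r"
  have "infdist (z + t *\<^sub>R g) Z \<le> dist (z + t *\<^sub>R g) z"
    using \<open>z \<in> Z\<close> by (rule infdist_le)
  also have "\<dots> = t"
    using t g(2) by (simp add: dist_norm)
  finally have "infdist (z + t *\<^sub>R g) Z powr p < r powr p"
    using t \<open>0 < p\<close> by (intro powr_less_mono2) (auto simp: infdist_nonneg)
  then have "L * infdist (z + t *\<^sub>R g) Z powr p < L * r powr p"
    using \<open>0 < L\<close> by simp
  then have "f (z + t *\<^sub>R g) < f x - \<epsilon>"
    using bound[of "z + t *\<^sub>R g"] r(2) by linarith
  then have "g \<bullet> (z + t *\<^sub>R g - x) \<le> 0"
    using g(1) by (auto simp: quasi_subdifferential_def)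
  then show "t \<le> g \<bullet> (x - z)"
    using g(2) by (simp add: inner_diff_right inner_add_right dot_square_norm)
qed

text \<open>Projection onto X is nonexpansive and fixes z, so only the unprojected step has to be
  expanded, with \<open>norm g = 1\<close>.\<close>

lemma projected_step_dist_le:
  fixes X :: "(real ^ 'n) set"
  assumes "convex X" "closed X" "z \<in> X" "norm g = 1" "0 \<le> v" "r \<le> g \<bullet> (x - z)"
  shows "(dist (closest_point X (x - v *\<^sub>R g)) z)\<^sup>2 \<le> (dist x z)\<^sup>2 - 2 * v * r + v\<^sup>2"
proof -
  have "dist (closest_point X (x - v *\<^sub>R g)) z \<le> dist (x - v *\<^sub>R g) z"
    using closest_point_lipschitz[of X "x - v *\<^sub>R g" z] assms(1-3)
    by (auto simp: closest_point_self)
  then have "(dist (closest_point X (x - v *\<^sub>R g)) z)\<^sup>2 \<le> (dist (x - v *\<^sub>R g) z)\<^sup>2"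
    by (intro power_mono) auto
  also have "\<dots> = (norm ((x - z) - v *\<^sub>R g))\<^sup>2"
    by (simp add: dist_norm algebra_simps)
  also have "\<dots> = (dist x z)\<^sup>2 - 2 * v * (g \<bullet> (x - z)) + v\<^sup>2"
    using assms(4) unfolding dist_norm power2_norm_eq_inner norm_eq_1
    by (simp add: inner_diff_left inner_diff_right inner_commute power2_eq_square algebra_simps)
  also have "\<dots> \<le> (dist x z)\<^sup>2 - 2 * v * r + v\<^sup>2"
    using mult_left_mono[OF assms(6), of "2 * v"] assms(5) by simp
  finally show ?thesis .
qed

text \<open>Turns a failed bound on the objective into a lower bound on the radius r of the test
  ball.\<close>

lemma less_powr_inverse_div:
  fixes a b L p :: real
  assumes "0 \<le> a" "0 < p" "0 < L" "a powr p < b"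
  shows "a / L powr (1 / p) < (b / L) powr (1 / p)"
proof -
  have "a = (a powr p) powr (1 / p)"
    using assms by (simp add: powr_powr)
  also have "\<dots> < b powr (1 / p)"
    using assms by (intro powr_less_mono2) auto
  finally have "a / L powr (1 / p) < b powr (1 / p) / L powr (1 / p)"
    using assms by (intro divide_strict_right_mono) auto
  also have "\<dots> = (b / L) powr (1 / p)"
    using assms by (subst powr_divide) (auto intro: less_imp_le[OF le_less_trans[OF powr_ge_zero]])
  finally show ?thesis .
qed

theorem theorem4p5:
  fixes X Xstar :: "(real ^ 'n) set"
    and f :: "real ^ 'n \<Rightarrow> real"
    and fstar p L \<epsilon> \<delta> :: real
    and v :: "nat \<Rightarrow> real"
    and g x :: "nat \<Rightarrow> real ^ 'n"
  assumes "X \<noteq> {}" and "closed X" and "convex X"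
    and "quasi_convex f" and "continuous_on UNIV f"
    and "fstar \<in> f ` X" and "\<forall>z\<in>X. fstar \<le> f z"
    and "Xstar = {z \<in> X. f z = fstar}"
    and "0 < p" and "p \<le> 1" and "0 < L"
    and "\<forall>z. f z - fstar \<le> L * infdist z Xstar powr p"
    and "0 < \<epsilon>" and "0 < \<delta>"
    and "inexact_subgradient_method X f \<epsilon> v g x"
  shows
    "(\<forall>v0 K1. 0 < v0 \<and> (\<forall>k\<ge>1. v k = v0) \<and>
        K1 = L powr (1 / p) * (infdist (x 1) Xstar)\<^sup>2 / (2 * v0 * \<delta>) \<longrightarrow>
        (MIN k\<in>iterations K1. f (x k))
          \<le> fstar + (1 / 2 * L powr (1 / p) * v0 + \<delta>) powr p + \<epsilon>)
     \<and>
     (\<forall>c s K2. 0 < c \<and> 0 < s \<and> s < 1 \<and> (\<forall>k\<ge>1. v k = c * real k powr (- s)) \<and>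
        K2 = ((1 - s) * L powr (1 / p) * (infdist (x 1) Xstar)\<^sup>2 / (2 * c * \<delta>))
               powr (1 / (1 - s)) \<longrightarrow>
        (\<exists>k\<in>iterations (corrected_count s K2).
           f (x k) \<le> fstar + (1 / 2 * L powr (1 / p) * c * real k powr (- s) + \<delta>) powr p + \<epsilon>))
     \<and>
     (\<forall>lam lo hi K3. 0 < lo \<and> hi < 2 \<and> (\<forall>k\<ge>1. lo \<le> lam k \<and> lam k \<le> hi) \<and>
        (\<forall>k\<ge>1. v k = lam k * (max 0 ((f (x k) - fstar - \<epsilon>) / L)) powr (1 / p)) \<and>
        K3 = L powr (2 / p) * (infdist (x 1) Xstar)\<^sup>2 / (lo * (2 - hi) * \<delta>\<^sup>2) \<longrightarrow>
        (MIN k\<in>iterations K3. f (x k)) \<le> fstar + \<delta> powr p + \<epsilon>)"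
proof -
  define M where "M = L powr (1 / p)"
  have M: "0 < M"
    using assms(11) by (simp add: M_def)
  have M2: "L powr (2 / p) = M\<^sup>2"
    using assms(11) by (simp add: M_def powr_power)
  have "Xstar = X \<inter> f -` {fstar}"
    using assms(8) by auto
  then have "closed Xstar"
    using assms(2,5) by (auto intro!: closed_Int closed_vimage simp: continuous_on_eq_continuous_within)
  moreover have "Xstar \<noteq> {}"
    using assms(6,8) by auto
  \<comment> \<open>The minimum nearest to \<open>x 1\<close> is fixed once and for all; later
    iterates are compared with this same z, whether or not it is nearest to them.\<close>
  ultimately obtain z where z: "z \<in> Xstar" "infdist (x 1) Xstar = dist (x 1) z"
    by (rule infdist_attains_inf)
  define a where "a k = (dist (x k) z)\<^sup>2" for k
  define r where "r k = ((f (x k) - fstar - \<epsilon>) / L) powr (1 / p)" for k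
  have a1: "(infdist (x 1) Xstar)\<^sup>2 = a 1"
    unfolding a_def z(2) by (rule refl)
  have a_nonneg: "0 \<le> a k" for k
    by (simp add: a_def)
  have "z \<in> X"
    using z(1) assms(8) by auto
  have step: "a (Suc k) \<le> a k - 2 * v k * r k + (v k)\<^sup>2"
    if k: "1 \<le> k" and "0 \<le> v k" "0 < f (x k) - fstar - \<epsilon>" for k
  proof -
    have g: "g k \<in> quasi_subdifferential \<epsilon> f (x k)" "norm (g k) = 1"
      and x: "x (Suc k) = closest_point X (x k - v k *\<^sub>R g k)"
      using assms(15) k by (auto simp: inexact_subgradient_method_def)
    have "r k \<le> g k \<bullet> (x k - z)"
    \<comment> \<open>For positive excess \<open>f (x k) - fstar - \<epsilon>\<close>,
      \<open>r k\<close> is the largest admissible radius: \<open>L * r k powr p\<close> equals the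
      excess.\<close>
    proof (rule quasi_subgradient_inner_ge[where Z = Xstar and fstar = fstar])
      show "L * r k powr p \<le> f (x k) - fstar - \<epsilon>" "0 < r k"
        using that assms(9,11) by (auto simp: r_def powr_powr)
    qed (use assms(9,11,12) z(1) g in auto)
    then show ?thesis
      unfolding a_def x using assms(2,3) \<open>z \<in> X\<close> g(2) \<open>0 \<le> v k\<close>
      by (intro projected_step_dist_le)
  qed
  \<comment> \<open>Serves parts (i) and (ii). Failure gives r > v/2 + \<delta>/M, so 2 v r exceeds
    v^2 + 2 v \<delta>/M; the square cancels against the one in \<open>step\<close>.\<close>
  have step_small: "a (Suc k) < a k - 2 * \<delta> / M * v k"
    if k: "1 \<le> k" and v: "0 < v k" and f: "fstar + (M * v k / 2 + \<delta>) powr p + \<epsilon> < f (x k)" for k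
  proof -
    have nonneg: "0 \<le> M * v k / 2 + \<delta>"
      using M v assms(14) by simp
    have less: "(M * v k / 2 + \<delta>) powr p < f (x k) - fstar - \<epsilon>"
      using f by simp
    have pos: "0 < f (x k) - fstar - \<epsilon>"
      using less powr_ge_zero by (rule le_less_trans[rotated])
    have "(M * v k / 2 + \<delta>) / M < r k"
      unfolding r_def M_def
      by (rule less_powr_inverse_div) (use assms(9,11) nonneg less in \<open>auto simp: M_def\<close>)
    then have "v k / 2 + \<delta> / M < r k"
      using M by (simp add: add_divide_distrib)
    then have "2 * v k * (v k / 2 + \<delta> / M) < 2 * v k * r k"
      using v by (intro mult_strict_left_mono) auto
    then show ?thesis
      using step[OF k _ pos] v by (simp add: algebra_simps power2_eq_square)
  qed
  have "\<exists>k\<in>iterations K1. f (x k) \<le> fstar + (1 / 2 * M * v0 + \<delta>) powr p + \<epsilon>"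
    if v0: "0 < v0" and v: "\<forall>k\<ge>1. v k = v0" and K1: "K1 = M * a 1 / (2 * v0 * \<delta>)" for v0 K1
  proof (rule exists_iterations_le[where a = a and w = "\<lambda>k. 2 * \<delta> / M * v0"])
    fix N assume "K1 \<le> real N"
    then show "a 1 \<le> (\<Sum>k = 1..N. 2 * \<delta> / M * v0)"
      using K1 M v0 assms(14) by (simp add: field_simps)
  next
    fix k :: nat
    assume "1 \<le> k" "fstar + (1 / 2 * M * v0 + \<delta>) powr p + \<epsilon> < f (x k)"
    then show "a (Suc k) < a k - 2 * \<delta> / M * v0"
      using step_small[of k] v v0 by simp
  qed (rule a_nonneg)
  moreover have "\<exists>k\<in>iterations (corrected_count s K2).
      f (x k) \<le> fstar + (1 / 2 * M * c * real k powr (- s) + \<delta>) powr p + \<epsilon>"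
    if c: "0 < c" and s: "0 < s" "s < 1" and v: "\<forall>k\<ge>1. v k = c * real k powr (- s)"
      and K2: "K2 = ((1 - s) * M * a 1 / (2 * c * \<delta>)) powr (1 / (1 - s))" for c s K2
  proof (rule exists_iterations_le[where a = a and w = "\<lambda>k. 2 * \<delta> / M * (c * real k powr (- s))"])
    fix N assume N: "corrected_count s K2 \<le> real N"
    \<comment> \<open>The exponents cancel because the base is nonnegative; base 0, when
      \<open>x 1\<close> is itself a minimum, is covered by 0 powr y = 0.\<close>
    have "K2 powr (1 - s) = (1 - s) * M * a 1 / (2 * c * \<delta>)"
      using s c M a_nonneg[of 1] assms(14) by (simp add: K2 powr_powr)
    moreover have "0 \<le> (1 - s) * M * a 1 / (2 * c * \<delta>)"
      using s c M a_nonneg[of 1] assms(14) by simp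
    ultimately have "(1 - s) * M * a 1 / (2 * c * \<delta>) =
        ((1 + K2 powr (1 - s)) powr (1 / (1 - s))) powr (1 - s) - 1"
      using s by (simp add: powr_powr)
    \<comment> \<open>The count was corrected so that N + 1 is at least the inner power; raising to
      1 - s > 0 is monotone.\<close>
    also have "\<dots> \<le> (real N + 1) powr (1 - s) - 1"
      using N s by (auto simp: corrected_count_def intro!: powr_mono2)
    finally have "M * a 1 / (2 * c * \<delta>) \<le> ((real N + 1) powr (1 - s) - 1) / (1 - s)"
      using s by (simp add: field_simps)
    also have "\<dots> \<le> (\<Sum>k=1..N. real k powr (- s))"
      using s by (rule sum_powr_minus_ge)
    finally have "a 1 \<le> 2 * \<delta> / M * c * (\<Sum>k=1..N. real k powr (- s))"
      using c M assms(14) by (simp add: field_simps)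
    then show "a 1 \<le> (\<Sum>k = 1..N. 2 * \<delta> / M * (c * real k powr (- s)))"
      by (simp add: sum_distrib_left mult.assoc)
  next
    fix k :: nat
    assume "1 \<le> k" "fstar + (1 / 2 * M * c * real k powr (- s) + \<delta>) powr p + \<epsilon> < f (x k)"
    then show "a (Suc k) < a k - 2 * \<delta> / M * (c * real k powr (- s))"
      using step_small[of k] v c by (simp add: mult.assoc)
  qed (rule a_nonneg)
  moreover have "\<exists>k\<in>iterations K3. f (x k) \<le> fstar + \<delta> powr p + \<epsilon>"
    if lo: "0 < lo" and hi: "hi < 2" and lam: "\<forall>k\<ge>1. lo \<le> lam k \<and> lam k \<le> hi"
      and v: "\<forall>k\<ge>1. v k = lam k * (max 0 ((f (x k) - fstar - \<epsilon>) / L)) powr (1 / p)"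
      and K3: "K3 = M\<^sup>2 * a 1 / (lo * (2 - hi) * \<delta>\<^sup>2)" for lam lo hi K3
  proof (rule exists_iterations_le[where a = a and w = "\<lambda>k. lo * (2 - hi) * (\<delta> / M)\<^sup>2"])
    fix N assume "K3 \<le> real N"
    moreover have "0 < lo * (2 - hi) * \<delta>\<^sup>2"
      using lo hi assms(14) by simp
    ultimately have "M\<^sup>2 * a 1 \<le> real N * (lo * (2 - hi) * \<delta>\<^sup>2)"
      by (simp add: K3 pos_divide_le_eq)
    then show "a 1 \<le> (\<Sum>k = 1..N. lo * (2 - hi) * (\<delta> / M)\<^sup>2)"
      using M by (simp add: power_divide pos_le_divide_eq mult.commute)
  next
    fix k :: nat
    assume k: "1 \<le> k" and "fstar + \<delta> powr p + \<epsilon> < f (x k)"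
    then have less: "\<delta> powr p < f (x k) - fstar - \<epsilon>"
      by simp
    have pos: "0 < f (x k) - fstar - \<epsilon>"
      using less powr_ge_zero by (rule le_less_trans[rotated])
    have r: "\<delta> / M < r k"
      unfolding r_def M_def
      using assms(9,11,14) less by (intro less_powr_inverse_div) auto
    \<comment> \<open>The truncation at 0 is inactive for positive excess. With this step size 2 v r
      - v^2 becomes \<lambda> (2 - \<lambda>) r^2.\<close>
    have vk: "v k = lam k * r k"
      using v k pos assms(11) by (simp add: r_def max_def)
    have lk: "lo \<le> lam k" "lam k \<le> hi"
      using lam k by auto
    have "0 \<le> v k"
      using lk lo by (simp add: vk r_def)
    have "(\<delta> / M)\<^sup>2 < (r k)\<^sup>2"
      using r M assms(14) by (intro power_strict_mono) auto
    then have "lo * (2 - hi) * (\<delta> / M)\<^sup>2 < lo * (2 - hi) * (r k)\<^sup>2"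
      using lo hi by (intro mult_strict_left_mono) auto
    \<comment> \<open>Factor by factor: \<lambda> is at least \<open>lo\<close>, and 2 - \<lambda>
      is at least 2 - \<open>hi\<close>, which is positive.\<close>
    also have "\<dots> \<le> lam k * (2 - lam k) * (r k)\<^sup>2"
      using lo hi lk by (intro mult_right_mono mult_mono) auto
    finally show "a (Suc k) < a k - lo * (2 - hi) * (\<delta> / M)\<^sup>2"
      using step[OF k \<open>0 \<le> v k\<close> pos] by (simp add: vk algebra_simps power2_eq_square)
  qed (rule a_nonneg)
  ultimately show ?thesis
    unfolding a1 M2 M_def[symmetric] by (intro conjI allI impI) (auto intro!: Min_iterations_le)
qed

end
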